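(* Let $n\in\{2,3\}$, and let $P_1,P_2\in\mathbb{R}^{n\times n}$ be symmetric positive definite real matrices such that \[ \|P_1\|_F^2\ge\|P_2\|_F^2,\qquad \|P_1^{-1}\|_F^2\ge\|P_2^{-1}\|_F^2,\qquad \det P_1=\det P_2 . \] Then \[ \|\log P_1\|_F^2\ \ge\ \|\log P_2\|_F^2 . \]
   Context: $\log$ denotes the principal matrix logarithm (for symmetric positive definite $P$, the unique real symmetric matrix $X$ with $\exp X=P$). $\|X\|_F^2=\sum_{i,j}X_{ij}^2$ is the squared Frobenius norm. *)

theory Defs
  imports "HOL-Analysis.Analysis"
begin

definition sym_pos_def :: "real^'n^'n \<Rightarrow> bool" where
  "sym_pos_def P \<longleftrightarrow> transpose P = P \<and> (\<forall>x. x \<noteq> 0 \<longrightarrow> x \<bullet> (P *v x) > 0)"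

definition frobenius_sq :: "real^'n^'m \<Rightarrow> real" where
  "frobenius_sq X = (\<Sum>i\<in>UNIV. \<Sum>j\<in>UNIV. (X $ i $ j)\<^sup>2)"

(* The type real^'n^'n is not an instance of the normed-algebra classes for the
   product **, so neither the overloaded power nor the overloaded exp applies. *)
primrec mat_power :: "real^'n^'n \<Rightarrow> nat \<Rightarrow> real^'n^'n" where
  "mat_power A 0 = mat 1"
| "mat_power A (Suc k) = A ** mat_power A k"

definition mat_exp :: "real^'n^'n \<Rightarrow> real^'n^'n" where
  "mat_exp A = (\<Sum>k. mat_power A k /\<^sub>R fact k)"

(* Meaningful only for symmetric positive definite P, where the real symmetric
   logarithm exists and is unique. *)
definition mat_log :: "real^'n^'n \<Rightarrow> real^'n^'n" where
  "mat_log P = (THE X. transpose X = X \<and> mat_exp X = P)"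

end

theory Submission
  imports Defs "HOL-Probability.Sinc_Integral"
begin

text \<open>
  Diagonalise both matrices orthogonally and let \<open>x i\<close> and \<open>y i\<close> be the squares of the
  eigenvalues of \<open>P1\<close> and \<open>P2\<close>.  Each quantity in the theorem depends on these numbers only:
  the hypotheses say that \<open>\<Sum> x \<ge> \<Sum> y\<close>, that \<open>\<Sum> 1/x \<ge> \<Sum> 1/y\<close> and that \<open>\<Prod> x = \<Prod> y\<close>, and the
  claim is \<open>\<Sum> (ln x)^2 \<ge> \<Sum> (ln y)^2\<close> up to the factor \<open>4\<close>.

  For two or three eigenvalues the polynomial \<open>\<Prod> (t + x i)\<close> has as coefficients, besides the
  leading one, just the sum, the product and, for three eigenvalues, the product times the sum of
  the inverses.  The hypotheses therefore give \<open>\<Prod> (t + x i) \<ge> \<Prod> (t + y i)\<close> for all \<open>t > 0\<close>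
  (lemma \<open>prod_shift_mono_card_2_3\<close>).

  In every dimension this family of inequalities implies the claim, because \<open>(ln x)^2\<close> is a
  positive superposition of the functions \<open>ln (t + x)\<close>, up to terms that cancel:
  \<open>(ln x)^2 = 2 \<integral>_0^\<infinity> (ln ((t + x) / (t + 1)) - [t < 1] ln x) dt / t\<close>.
  With \<open>t = e^s\<close> and \<open>x = e^u\<close> the measure \<open>dt / t\<close> becomes Lebesgue measure, and the function
  \<open>ln (e^s + e^u)\<close> is the maximum of \<open>s\<close> and \<open>u\<close> plus a function of \<open>s - u\<close>.  The integral of
  that second function does not depend on \<open>u\<close>, and the maximum contributes \<open>u^2 / 2\<close> after
  subtraction of terms that agree on both sides, since \<open>\<Sum> u = \<Sum> v\<close>.  This is
  \<open>sum_squares_mono_of_sum_ln_add_exp\<close>.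

  The reduction to eigenvalues rests on the spectral theorem
  \<open>symmetric_matrix_orthogonal_diagonalization\<close> and on the fact that \<open>mat_log\<close> takes the
  logarithm of each eigenvalue (\<open>mat_log_conj_diag\<close>).
\<close>

section \<open>Sums of squared logarithms by integration over shifts\<close>

text \<open>
  The excess of \<open>ln (exp a + exp b)\<close> over \<open>max a b\<close> depends only on \<open>a - b\<close>; it is this function
  of the difference.
\<close>

definition softplus_gap :: "real \<Rightarrow> real" where
  "softplus_gap x = ln (1 + exp (- \<bar>x\<bar>))"

lemma integrable_softplus_gap: "integrable lborel softplus_gap"
proof -
  have dom: "integrable lborel (\<lambda>x::real. 2 * inverse (1 + x\<^sup>2))"
    using integrable_inverse_1_plus_square by (simp add: set_integrable_def einterval_def)
  have bound: "norm (softplus_gap x) \<le> norm (2 * inverse (1 + x\<^sup>2))" for x :: real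
  proof -
    have "softplus_gap x \<le> exp (- \<bar>x\<bar>)"
      unfolding softplus_gap_def by (rule ln_add_one_self_le_self) simp
    also have "\<dots> = inverse (exp \<bar>x\<bar>)"
      by (simp add: exp_minus)
    also have "\<dots> \<le> inverse ((1 + x\<^sup>2) / 2)"
    proof (rule le_imp_inverse_le)
      have "1 + \<bar>x\<bar> + \<bar>x\<bar>\<^sup>2 / 2 \<le> exp \<bar>x\<bar>"
        by (rule exp_lower_Taylor_quadratic) simp
      then show "(1 + x\<^sup>2) / 2 \<le> exp \<bar>x\<bar>"
        by (simp add: field_simps)
      show "0 < (1 + x\<^sup>2) / 2"
        by (simp add: add_pos_nonneg)
    qed
    also have "\<dots> = 2 / (1 + x\<^sup>2)"
      by (rule inverse_divide)
    also have "\<dots> = 2 * inverse (1 + x\<^sup>2)"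
      by (rule divide_inverse)
    finally have "softplus_gap x \<le> 2 * inverse (1 + x\<^sup>2)" .
    moreover have "0 \<le> softplus_gap x"
      by (simp add: softplus_gap_def)
    ultimately show ?thesis
      by simp
  qed
  have "softplus_gap \<in> borel_measurable lborel"
    unfolding softplus_gap_def by measurable
  then show ?thesis
    using Bochner_Integration.integrable_bound[OF dom] bound by blast
qed

text \<open>
  The maximum of \<open>s\<close> and \<open>u\<close> as a function of \<open>s\<close> is not integrable.  Removing its behaviour at
  both ends, by terms constant or linear in \<open>u\<close>, leaves a triangle of height \<open>\<bar>u\<bar>\<close> and base
  \<open>\<bar>u\<bar>\<close>, between \<open>0\<close> and \<open>u\<close>, whose area produces the square.
\<close>

definition hinge :: "real \<Rightarrow> real \<Rightarrow> real" where
  "hinge u s = max s u - max s 0 - (if s < 0 then u else 0)"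

lemma has_bochner_integral_hinge: "has_bochner_integral lborel (hinge u) (u\<^sup>2 / 2)"
proof (cases "0 \<le> u")
  case True
  have "has_bochner_integral lborel (\<lambda>s. (u - s) * indicator {0..u} s)
          ((u * u - u\<^sup>2 / 2) - (u * 0 - 0\<^sup>2 / 2))"
    by (rule has_bochner_integral_FTC_Icc_real)
       (use True in \<open>auto intro!: derivative_eq_intros continuous_intros\<close>)
  moreover have "(\<lambda>s. (u - s) * indicator {0..u} s) = hinge u"
    using True by (auto simp: fun_eq_iff hinge_def indicator_def max_def)
  ultimately show ?thesis
    by (simp add: power2_eq_square)
next
  case False
  have "has_bochner_integral lborel (\<lambda>s. (s - u) * indicator {u..0} s)
          ((0\<^sup>2 / 2 - u * 0) - (u\<^sup>2 / 2 - u * u))"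
    by (rule has_bochner_integral_FTC_Icc_real)
       (use False in \<open>auto intro!: derivative_eq_intros continuous_intros\<close>)
  (* hinge u jumps at 0, so for negative u the two functions differ there *)
  moreover have "has_bochner_integral lborel (\<lambda>s. (s - u) * indicator {u..0} s) c \<longleftrightarrow>
      has_bochner_integral lborel (hinge u) c" for c
    by (rule has_bochner_integral_discrete_difference[where X = "{0}"])
       (use False in \<open>auto simp: hinge_def indicator_def max_def\<close>)
  ultimately show ?thesis
    by (simp add: power2_eq_square)
qed

lemma ln_add_exp_decomp:
  "ln (exp s + exp u) =
     hinge u s + softplus_gap (s - u) + max s 0 + (if s < 0 then u else 0)"
proof -
  have "exp s + exp u = exp (max s u) * (1 + exp (- \<bar>s - u\<bar>))"
    by (auto simp: max_def abs_if algebra_simps simp flip: exp_add)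
  then have "ln (exp s + exp u) = max s u + ln (1 + exp (- \<bar>s - u\<bar>))"
    by (simp add: ln_mult_pos add_pos_pos)
  then show ?thesis
    by (simp add: hinge_def softplus_gap_def)
qed

text \<open>
  Integrating the hypothesis over all \<open>s\<close>, after the common non-integrable part has been
  cancelled, yields half of the claimed inequality: every index contributes half its square and
  the same constant \<open>K\<close>, by translation invariance of Lebesgue measure.
\<close>

lemma sum_squares_mono_of_sum_ln_add_exp:
  fixes u v :: "'i \<Rightarrow> real"
  assumes eq: "(\<Sum>i\<in>I. u i) = (\<Sum>i\<in>I. v i)"
    and le: "\<And>s. (\<Sum>i\<in>I. ln (exp s + exp (v i))) \<le> (\<Sum>i\<in>I. ln (exp s + exp (u i)))"
  shows "(\<Sum>i\<in>I. (v i)\<^sup>2) \<le> (\<Sum>i\<in>I. (u i)\<^sup>2)"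
proof -
  define K where "K = integral\<^sup>L lborel softplus_gap"
  define F where "F w s = (\<Sum>i\<in>I. hinge (w i) s + softplus_gap (s - w i))"
    for w :: "'i \<Rightarrow> real" and s
  have shift: "has_bochner_integral lborel (\<lambda>s. softplus_gap (s - c)) K" for c
    using lborel_integrable_real_affine[OF integrable_softplus_gap, of 1 "- c"]
      lborel_integral_real_affine[of 1 softplus_gap "- c"]
    by (simp add: has_bochner_integral_iff K_def)
  have int: "has_bochner_integral lborel (F w) (\<Sum>i\<in>I. (w i)\<^sup>2 / 2 + K)" for w
    unfolding F_def
    by (intro has_bochner_integral_sum has_bochner_integral_add
          has_bochner_integral_hinge shift)
  have split: "(\<Sum>i\<in>I. ln (exp s + exp (w i))) =
      F w s + of_nat (card I) * max s 0 + (if s < 0 then \<Sum>i\<in>I. w i else 0)" for w s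
    by (simp add: ln_add_exp_decomp F_def sum.distrib)
  have "F v s \<le> F u s" for s
    using le[of s] unfolding split eq by simp
  then have "(\<Sum>i\<in>I. (v i)\<^sup>2 / 2 + K) \<le> (\<Sum>i\<in>I. (u i)\<^sup>2 / 2 + K)"
    using int[of u] int[of v] by (metis has_bochner_integral_iff integral_mono)
  then show ?thesis
    by (simp add: sum.distrib flip: sum_divide_distrib)
qed

lemma sum_squared_ln_mono_of_prod_shift:
  fixes x y :: "'i \<Rightarrow> real"
  assumes pos: "\<And>i. i \<in> I \<Longrightarrow> 0 < x i" "\<And>i. i \<in> I \<Longrightarrow> 0 < y i"
    and eq: "(\<Prod>i\<in>I. x i) = (\<Prod>i\<in>I. y i)"
    and le: "\<And>t. 0 < t \<Longrightarrow> (\<Prod>i\<in>I. t + y i) \<le> (\<Prod>i\<in>I. t + x i)"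
  shows "(\<Sum>i\<in>I. (ln (y i))\<^sup>2) \<le> (\<Sum>i\<in>I. (ln (x i))\<^sup>2)"
proof (cases "finite I")
  case True
  have ln_prod': "ln (\<Prod>i\<in>I. t + z i) = (\<Sum>i\<in>I. ln (t + z i))"
    if t: "0 \<le> t" and z: "\<And>i. i \<in> I \<Longrightarrow> 0 < z i" for t and z :: "'i \<Rightarrow> real"
  proof (rule ln_prod[OF True])
    fix i assume "i \<in> I"
    then show "t + z i \<noteq> 0"
      using z[of i] t by linarith
  qed
  have exp_ln_sum: "(\<Sum>i\<in>I. ln (exp s + exp (ln (z i)))) = ln (\<Prod>i\<in>I. exp s + z i)"
    if z: "\<And>i. i \<in> I \<Longrightarrow> 0 < z i" for s and z :: "'i \<Rightarrow> real"
  proof -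
    have "ln (\<Prod>i\<in>I. exp s + z i) = (\<Sum>i\<in>I. ln (exp s + z i))"
      by (rule ln_prod') (simp_all only: exp_ge_zero z)
    also have "\<dots> = (\<Sum>i\<in>I. ln (exp s + exp (ln (z i))))"
      by (rule sum.cong) (simp_all only: exp_ln z)
    finally show ?thesis ..
  qed
  show ?thesis
  proof (rule sum_squares_mono_of_sum_ln_add_exp)
    show "(\<Sum>i\<in>I. ln (x i)) = (\<Sum>i\<in>I. ln (y i))"
      using ln_prod'[of 0 x] ln_prod'[of 0 y] pos eq by simp
  next
    fix s :: real
    have "0 < (\<Prod>i\<in>I. exp s + y i)"
      using pos(2) by (intro prod_pos ballI add_pos_pos exp_gt_zero) blast
    then have "ln (\<Prod>i\<in>I. exp s + y i) \<le> ln (\<Prod>i\<in>I. exp s + x i)"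
      by (rule ln_mono[OF le[OF exp_gt_zero]])
    then show "(\<Sum>i\<in>I. ln (exp s + exp (ln (y i)))) \<le> (\<Sum>i\<in>I. ln (exp s + exp (ln (x i))))"
      by (simp only: exp_ln_sum pos)
  qed
qed simp

section \<open>The spectral theorem for real symmetric matrices\<close>

text \<open>
  A maximiser \<open>v\<close> of the quadratic form on the unit sphere of the subspace is an eigenvector: if
  the residual \<open>h = m *\<^sub>R v - f v\<close> were nonzero, then moving \<open>v\<close> a little against \<open>h\<close> would
  raise the Rayleigh quotient above its maximum \<open>m\<close>.
\<close>

lemma self_adjoint_eigenvector_in_invariant_subspace:
  fixes f :: "'a::euclidean_space \<Rightarrow> 'a"
  assumes lin: "linear f" and adj: "\<And>x y. f x \<bullet> y = x \<bullet> f y"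
    and S: "subspace S" "f ` S \<subseteq> S" and nz: "z \<in> S" "z \<noteq> 0"
  obtains v c where "v \<in> S" "norm v = 1" "f v = c *\<^sub>R v"
proof -
  have "compact (sphere 0 1 \<inter> S)"
    using closed_subspace[OF S(1)] by (simp add: compact_Int_closed)
  moreover have "z /\<^sub>R norm z \<in> sphere 0 1 \<inter> S"
    using nz S(1) by (simp add: subspace_scale)
  moreover have "continuous_on (sphere 0 1 \<inter> S) (\<lambda>x. x \<bullet> f x)"
    using lin by (intro continuous_intros linear_continuous_on) (simp add: linear_linear)
  ultimately obtain v where v: "v \<in> sphere 0 1 \<inter> S"
    and vmax: "\<And>x. x \<in> sphere 0 1 \<inter> S \<Longrightarrow> x \<bullet> f x \<le> v \<bullet> f v"
    using continuous_attains_sup[of "sphere 0 1 \<inter> S" "\<lambda>x. x \<bullet> f x"] by blast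
  define m where "m = v \<bullet> f v"
  have vS: "v \<in> S" and v1: "v \<bullet> v = 1" and vn: "norm v = 1"
    using v by (auto simp: dot_square_norm)
  have rayleigh: "w \<bullet> f w \<le> m * (w \<bullet> w)" if "w \<in> S" for w
  proof (cases "w = 0")
    case False
    have "(w /\<^sub>R norm w) \<bullet> f (w /\<^sub>R norm w) \<le> m"
      unfolding m_def using that False S(1) by (intro vmax) (simp add: subspace_scale)
    then have "(w \<bullet> f w) / (norm w)\<^sup>2 \<le> m"
      by (simp add: linear_scale[OF lin] power2_eq_square field_simps)
    then show ?thesis
      using False by (simp add: dot_square_norm divide_le_eq)
  qed (simp add: linear_0[OF lin])
  define h where "h = m *\<^sub>R v - f v"
  have hS: "h \<in> S"
    unfolding h_def using S vS by (intro subspace_diff subspace_scale) auto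
  define C where "C = m * (h \<bullet> h) - h \<bullet> f h"
  have C0: "0 \<le> C"
    using rayleigh[OF hS] by (simp add: C_def)
  have perturb: "2 * (h \<bullet> h) * e \<le> e\<^sup>2 * C" for e
  proof -
    have "v - e *\<^sub>R h \<in> S"
      using S(1) vS hS by (intro subspace_diff subspace_scale)
    from rayleigh[OF this]
    moreover have "(v - e *\<^sub>R h) \<bullet> f (v - e *\<^sub>R h) = m - 2 * e * (h \<bullet> f v) + e\<^sup>2 * (h \<bullet> f h)"
      using adj[of v h]
      by (simp add: linear_diff[OF lin] linear_scale[OF lin] inner_diff_left inner_diff_right
          m_def inner_commute power2_eq_square algebra_simps)
    moreover have "(v - e *\<^sub>R h) \<bullet> (v - e *\<^sub>R h) = 1 - 2 * e * (h \<bullet> v) + e\<^sup>2 * (h \<bullet> h)"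
      by (simp add: inner_diff_left inner_diff_right v1 inner_commute power2_eq_square
          algebra_simps)
    ultimately have "m - 2 * e * (h \<bullet> f v) + e\<^sup>2 * (h \<bullet> f h) \<le>
        m * (1 - 2 * e * (h \<bullet> v) + e\<^sup>2 * (h \<bullet> h))"
      by simp
    moreover have hh: "h \<bullet> h = m * (h \<bullet> v) - h \<bullet> f v"
      by (subst (2) h_def) (simp add: inner_diff_right)
    have "2 * (h \<bullet> h) * e = 2 * e * (m * (h \<bullet> v)) - 2 * e * (h \<bullet> f v)"
      unfolding hh by (simp add: algebra_simps)
    ultimately show ?thesis
      by (simp add: C_def algebra_simps)
  qed
  have "h \<bullet> h = 0"
  proof (rule ccontr)
    assume "h \<bullet> h \<noteq> 0"
    then have hp: "0 < h \<bullet> h"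
      by simp
    (* a step so small that the quadratic term cannot compensate the linear one *)
    define e where "e = (h \<bullet> h) / (C + 1)"
    have e: "0 < e" "e * C \<le> h \<bullet> h"
      using hp C0 by (auto simp: e_def field_simps)
    have "e * (2 * (h \<bullet> h)) \<le> e * (e * C)"
      using perturb[of e] by (simp add: power2_eq_square algebra_simps)
    then have "2 * (h \<bullet> h) \<le> e * C"
      using e(1) by (simp only: mult_le_cancel_left_pos)
    then show False
      using e(2) hp by linarith
  qed
  then have "f v = m *\<^sub>R v"
    by (simp add: h_def)
  with vS vn show thesis
    by (rule that)
qed

text \<open>
  An orthonormal system of eigenvectors that is too small to span can be enlarged, since its
  orthogonal complement is again invariant under a self-adjoint map.
\<close>

lemma self_adjoint_orthonormal_eigenvectors:
  fixes f :: "'a::euclidean_space \<Rightarrow> 'a"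
  assumes lin: "linear f" and adj: "\<And>x y. f x \<bullet> y = x \<bullet> f y"
  shows "k \<le> DIM('a) \<Longrightarrow> \<exists>B. finite B \<and> card B = k \<and> pairwise orthogonal B \<and>
           (\<forall>b\<in>B. norm b = 1 \<and> (\<exists>c. f b = c *\<^sub>R b))"
proof (induction k)
  case 0
  show ?case
    by (intro exI[of _ "{}"]) simp
next
  case (Suc k)
  then obtain B where B: "finite B" "card B = k" "pairwise orthogonal B"
    and eig: "\<And>b. b \<in> B \<Longrightarrow> norm b = 1 \<and> (\<exists>c. f b = c *\<^sub>R b)"
    by auto
  define S where "S = {y. \<forall>b\<in>B. orthogonal b y}"
  have "dim B < DIM('a)"
    using dim_le_card'[OF B(1)] B(2) Suc.prems by simp
  then obtain z where z: "z \<noteq> 0" "\<And>y. y \<in> span B \<Longrightarrow> orthogonal z y"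
    using orthogonal_to_subspace_exists by blast
  have "z \<in> S"
    using z(2) by (auto simp: S_def span_base orthogonal_commute)
  moreover have "f ` S \<subseteq> S"
  proof (clarsimp simp: S_def)
    fix y b assume "\<forall>b\<in>B. orthogonal b y" "b \<in> B"
    moreover obtain c where "f b = c *\<^sub>R b"
      using eig \<open>b \<in> B\<close> by blast
    ultimately show "orthogonal b (f y)"
      by (simp add: orthogonal_def flip: adj)
  qed
  moreover have "subspace S"
    unfolding S_def by (rule subspace_orthogonal_to_vectors)
  ultimately obtain v c where v: "v \<in> S" "norm v = 1" "f v = c *\<^sub>R v"
    using self_adjoint_eigenvector_in_invariant_subspace[OF lin adj] z(1) by metis
  have "v \<notin> B"
    using v(1,2) by (auto simp: S_def orthogonal_def)
  moreover have "pairwise orthogonal (insert v B)"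
    using B(3) v(1) by (auto simp: pairwise_insert S_def orthogonal_commute)
  ultimately show ?case
    using B(1,2) eig v(2,3) by (intro exI[of _ "insert v B"]) auto
qed

definition diag_mat :: "('n \<Rightarrow> real) \<Rightarrow> real^'n^'n" where
  "diag_mat d = (\<chi> i j. if i = j then d i else 0)"

definition conj_diag :: "real^'n^'n \<Rightarrow> ('n \<Rightarrow> real) \<Rightarrow> real^'n^'n" where
  "conj_diag Q d = Q ** diag_mat d ** transpose Q"

lemma matrix_mult_diag_mat: "(A ** diag_mat d) $ i $ j = A $ i $ j * d j"
  by (simp add: matrix_matrix_mult_def diag_mat_def if_distrib if_distribR cong: if_cong)

lemma diag_mat_mult_matrix: "(diag_mat d ** A) $ i $ j = d i * A $ i $ j"
  by (simp add: matrix_matrix_mult_def diag_mat_def if_distrib if_distribR cong: if_cong)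

lemma conj_diag_nth: "conj_diag Q d $ i $ j = (\<Sum>k\<in>UNIV. Q $ i $ k * d k * Q $ j $ k)"
  by (simp add: conj_diag_def matrix_matrix_mult_def[of "Q ** diag_mat d"]
      matrix_mult_diag_mat transpose_def)

lemma symmetric_matrix_orthogonal_diagonalization:
  fixes A :: "real^'n^'n"
  assumes sym: "transpose A = A"
  obtains Q d where "orthogonal_matrix Q" "A = conj_diag Q d"
proof -
  have adj: "(A *v x) \<bullet> y = x \<bullet> (A *v y)" for x y
    by (metis dot_lmul_matrix sym vector_transpose_matrix)
  obtain B where B: "finite B" "card B = CARD('n)" "pairwise orthogonal B"
    and eig: "\<And>b. b \<in> B \<Longrightarrow> norm b = 1 \<and> (\<exists>c. A *v b = c *\<^sub>R b)"
    using self_adjoint_orthonormal_eigenvectors[OF matrix_vector_mul_linear adj, of "CARD('n)"]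
    by auto
  obtain q where q: "bij_betw q (UNIV :: 'n set) B"
    using finite_same_card_bij[of "UNIV :: 'n set" B] B by auto
  have qB: "q k \<in> B" for k
    using q by (auto simp: bij_betw_def)
  then have "\<forall>k. \<exists>c. A *v q k = c *\<^sub>R q k"
    using eig by blast
  then obtain d where d: "\<And>k. A *v q k = d k *\<^sub>R q k"
    by metis
  define Q :: "real^'n^'n" where "Q = (\<chi> i k. q k $ i)"
  have col: "column k Q = q k" for k
    by (simp add: Q_def column_def vec_eq_iff)
  have "q j \<noteq> q k" if "j \<noteq> k" for j k
    using q that by (auto simp: bij_betw_def inj_on_def)
  then have orth: "orthogonal_matrix Q"
    unfolding orthogonal_matrix_orthonormal_columns col
    using eig qB B(3) by (auto simp: pairwise_def)
  have "A ** Q = Q ** diag_mat d"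
  proof (simp add: vec_eq_iff matrix_mult_diag_mat, intro allI)
    fix i k
    have "(A ** Q) $ i $ k = (A *v q k) $ i"
      by (simp add: matrix_matrix_mult_def matrix_vector_mult_def Q_def)
    then show "(A ** Q) $ i $ k = Q $ i $ k * d k"
      by (simp add: d Q_def)
  qed
  then have "A ** (Q ** transpose Q) = conj_diag Q d"
    by (simp add: conj_diag_def matrix_mul_assoc)
  then have "A = conj_diag Q d"
    using orth by (simp add: orthogonal_matrix_def)
  with orth show thesis
    by (rule that)
qed

section \<open>Functions of a diagonalised matrix\<close>

lemma transpose_conj_diag: "transpose (conj_diag Q d) = conj_diag Q d"
  by (simp add: vec_eq_iff transpose_def conj_diag_nth mult.commute mult.left_commute)

lemma conj_diag_one:
  fixes Q :: "real^'n^'n"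
  assumes "orthogonal_matrix Q"
  shows "conj_diag Q (\<lambda>_. 1) = mat 1"
proof -
  have "diag_mat (\<lambda>_. 1) = (mat 1 :: real^'n^'n)"
    by (simp add: diag_mat_def mat_def)
  then show ?thesis
    using assms by (simp add: conj_diag_def orthogonal_matrix_def)
qed

lemma conj_diag_mult:
  assumes "orthogonal_matrix Q"
  shows "conj_diag Q d ** conj_diag Q e = conj_diag Q (\<lambda>i. d i * e i)"
proof -
  have "conj_diag Q d ** conj_diag Q e =
      Q ** (diag_mat d ** ((transpose Q ** Q) ** diag_mat e)) ** transpose Q"
    by (simp add: conj_diag_def matrix_mul_assoc)
  also have "\<dots> = Q ** (diag_mat d ** diag_mat e) ** transpose Q"
    using assms by (simp add: orthogonal_matrix)
  also have "diag_mat d ** diag_mat e = diag_mat (\<lambda>i. d i * e i)"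
    by (simp add: vec_eq_iff matrix_mult_diag_mat) (simp add: diag_mat_def)
  finally show ?thesis
    by (simp add: conj_diag_def)
qed

lemma trace_conj_diag:
  assumes "orthogonal_matrix Q"
  shows "trace (conj_diag Q d) = (\<Sum>i\<in>UNIV. d i)"
proof -
  have "trace (conj_diag Q d) = trace (transpose Q ** (Q ** diag_mat d))"
    unfolding conj_diag_def by (rule trace_mul_sym)
  also have "\<dots> = trace (diag_mat d)"
    using assms by (simp add: matrix_mul_assoc orthogonal_matrix)
  finally show ?thesis
    by (simp add: trace_def diag_mat_def)
qed

lemma frobenius_sq_conj_diag:
  assumes "orthogonal_matrix Q"
  shows "frobenius_sq (conj_diag Q d) = (\<Sum>i\<in>UNIV. (d i)\<^sup>2)"
proof -
  have "frobenius_sq (conj_diag Q d) = trace (conj_diag Q d ** transpose (conj_diag Q d))"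
    by (simp add: frobenius_sq_def trace_def matrix_matrix_mult_def transpose_def power2_eq_square)
  then show ?thesis
    using assms by (simp add: transpose_conj_diag conj_diag_mult trace_conj_diag power2_eq_square)
qed

lemma det_conj_diag:
  fixes Q :: "real^'n^'n"
  assumes "orthogonal_matrix Q"
  shows "det (conj_diag Q d) = (\<Prod>i\<in>UNIV. d i)"
proof -
  have "det Q * det (transpose Q) = 1"
    using assms by (metis det_I det_mul orthogonal_matrix_def)
  moreover have "det (diag_mat d :: real^'n^'n) = (\<Prod>i\<in>UNIV. d i)"
    by (subst det_diagonal) (simp_all add: diag_mat_def)
  ultimately show ?thesis
    by (simp add: conj_diag_def det_mul)
qed

lemma matrix_inv_unique:
  fixes A B :: "real^'n^'n"
  assumes "A ** B = mat 1" "B ** A = mat 1"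
  shows "matrix_inv A = B"
proof -
  have "matrix_inv A ** A = mat 1"
    unfolding matrix_inv_def by (rule someI2[of _ B]) (use assms in auto)
  then show ?thesis
    by (metis assms(1) matrix_mul_assoc matrix_mul_lid matrix_mul_rid)
qed

lemma matrix_inv_conj_diag:
  assumes "orthogonal_matrix Q" "\<And>i. d i \<noteq> 0"
  shows "matrix_inv (conj_diag Q d) = conj_diag Q (\<lambda>i. inverse (d i))"
proof -
  have "conj_diag Q d ** conj_diag Q (\<lambda>i. inverse (d i)) = mat 1"
    "conj_diag Q (\<lambda>i. inverse (d i)) ** conj_diag Q d = mat 1"
    using assms by (simp_all add: conj_diag_mult conj_diag_one)
  then show ?thesis
    by (rule matrix_inv_unique)
qed

lemma mat_power_conj_diag:
  assumes "orthogonal_matrix Q"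
  shows "mat_power (conj_diag Q d) k = conj_diag Q (\<lambda>i. d i ^ k)"
  using assms by (induction k) (simp_all add: conj_diag_one conj_diag_mult)

lemma mat_exp_conj_diag:
  assumes "orthogonal_matrix Q"
  shows "mat_exp (conj_diag Q d) = conj_diag Q (\<lambda>i. exp (d i))"
proof -
  have "(\<lambda>k. conj_diag Q (\<lambda>i. d i ^ k) /\<^sub>R fact k) sums conj_diag Q (\<lambda>i. exp (d i))"
    unfolding sums_def
  proof (intro vec_tendstoI)
    fix i j
    have "(\<lambda>k. \<Sum>l\<in>UNIV. Q $ i $ l * (d l ^ k /\<^sub>R fact k) * Q $ j $ l)
        sums (\<Sum>l\<in>UNIV. Q $ i $ l * exp (d l) * Q $ j $ l)"
      by (intro sums_sum sums_mult sums_mult2 exp_converges)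
    then show "(\<lambda>n. (\<Sum>k<n. conj_diag Q (\<lambda>i. d i ^ k) /\<^sub>R fact k) $ i $ j)
        \<longlonglongrightarrow> conj_diag Q (\<lambda>i. exp (d i)) $ i $ j"
      by (simp add: sums_def conj_diag_nth sum_distrib_left mult.assoc mult.left_commute)
  qed
  then show ?thesis
    using assms by (simp add: mat_exp_def mat_power_conj_diag sums_iff)
qed

text \<open>
  Applying a function to the eigenvalues gives the same matrix for each diagonalisation.  In
  terms of the change of basis \<open>C\<close>, equality of the two matrices means that \<open>C\<close> intertwines
  the diagonals, so that an entry of \<open>C\<close> can be nonzero only where the eigenvalues agree, and
  there the function values agree too.
\<close>

lemma conj_diag_apply_cong:
  fixes Q R :: "real^'n^'n"
  assumes Q: "orthogonal_matrix Q" and R: "orthogonal_matrix R"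
    and eq: "conj_diag Q d = conj_diag R e"
  shows "conj_diag Q (\<lambda>i. f (d i)) = conj_diag R (\<lambda>i. f (e i))"
proof -
  have QQ: "transpose Q ** Q = mat 1" "Q ** transpose Q = mat 1"
    and RR: "transpose R ** R = mat 1" "R ** transpose R = mat 1"
    using Q R by (simp_all add: orthogonal_matrix_def)
  define C where "C = transpose Q ** R"
  have comm: "conj_diag Q a = conj_diag R b \<longleftrightarrow> diag_mat a ** C = C ** diag_mat b" for a b
  proof
    assume "conj_diag Q a = conj_diag R b"
    then have "transpose Q ** conj_diag Q a ** R = transpose Q ** conj_diag R b ** R"
      by simp
    then have "(transpose Q ** Q) ** diag_mat a ** C = C ** diag_mat b ** (transpose R ** R)"
      by (simp only: conj_diag_def C_def matrix_mul_assoc)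
    then show "diag_mat a ** C = C ** diag_mat b"
      by (simp add: QQ RR)
  next
    assume "diag_mat a ** C = C ** diag_mat b"
    then have "Q ** (diag_mat a ** C) ** transpose R = Q ** (C ** diag_mat b) ** transpose R"
      by simp
    then have "Q ** diag_mat a ** transpose Q ** (R ** transpose R) =
        (Q ** transpose Q) ** R ** diag_mat b ** transpose R"
      by (simp only: C_def matrix_mul_assoc)
    then show "conj_diag Q a = conj_diag R b"
      by (simp add: QQ RR conj_diag_def)
  qed
  have "d i * C $ i $ j = C $ i $ j * e j" for i j
    using eq[unfolded comm] by (metis diag_mat_mult_matrix matrix_mult_diag_mat)
  then have agree: "C $ i $ j = 0 \<or> d i = e j" for i j
    by (simp add: mult.commute)
  have "f (d i) * C $ i $ j = C $ i $ j * f (e j)" for i j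
    using agree[of i j] by auto
  then show ?thesis
    unfolding comm by (simp add: vec_eq_iff diag_mat_mult_matrix matrix_mult_diag_mat)
qed

text \<open>
  A symmetric \<open>X\<close> with \<open>mat_exp X = P\<close> is diagonalisable, and each diagonalisation of \<open>X\<close>
  exponentiates to one of \<open>P\<close>; taking logarithms of the eigenvalues in either diagonalisation
  of \<open>P\<close> gives the same matrix, which makes \<open>X\<close> unique.
\<close>

lemma mat_log_conj_diag:
  assumes Q: "orthogonal_matrix Q" and pos: "\<And>i. 0 < d i"
  shows "mat_log (conj_diag Q d) = conj_diag Q (\<lambda>i. ln (d i))"
  unfolding mat_log_def
proof (rule the_equality)
  show "transpose (conj_diag Q (\<lambda>i. ln (d i))) = conj_diag Q (\<lambda>i. ln (d i)) \<and>
      mat_exp (conj_diag Q (\<lambda>i. ln (d i))) = conj_diag Q d"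
    using pos by (simp add: transpose_conj_diag mat_exp_conj_diag[OF Q])
next
  fix X assume X: "transpose X = X \<and> mat_exp X = conj_diag Q d"
  then obtain R e where R: "orthogonal_matrix R" and Xe: "X = conj_diag R e"
    using symmetric_matrix_orthogonal_diagonalization by blast
  have "conj_diag R (\<lambda>i. exp (e i)) = conj_diag Q d"
    using X by (simp add: Xe mat_exp_conj_diag[OF R])
  from conj_diag_apply_cong[OF R Q this, of ln]
  show "X = conj_diag Q (\<lambda>i. ln (d i))"
    by (simp add: Xe)
qed

lemma sym_pos_def_diagonalization:
  fixes P :: "real^'n^'n"
  assumes P: "sym_pos_def P"
  obtains Q d where "orthogonal_matrix Q" "\<And>i. 0 < d i" "P = conj_diag Q d"
proof -
  obtain Q d where Q: "orthogonal_matrix Q" and Pd: "P = conj_diag Q d"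
    using symmetric_matrix_orthogonal_diagonalization P unfolding sym_pos_def_def by blast
  have "0 < d i" for i
  proof -
    have "P ** Q = Q ** diag_mat d ** (transpose Q ** Q)"
      by (simp only: Pd conj_diag_def matrix_mul_assoc)
    then have PQ: "P ** Q = Q ** diag_mat d"
      using Q by (simp add: orthogonal_matrix)
    have "(P *v column i Q) $ k = (P ** Q) $ k $ i" for k
      by (simp add: matrix_matrix_mult_def matrix_vector_mult_def column_def)
    then have "P *v column i Q = d i *\<^sub>R column i Q"
      by (simp add: vec_eq_iff PQ matrix_mult_diag_mat) (simp add: column_def)
    moreover have n: "norm (column i Q) = 1"
      using Q by (simp add: orthogonal_matrix_orthonormal_columns)
    ultimately have "column i Q \<bullet> (P *v column i Q) = d i"
      by (simp add: dot_square_norm)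
    moreover have "column i Q \<noteq> 0"
      using n by auto
    ultimately show ?thesis
      using P by (metis sym_pos_def_def)
  qed
  with Q Pd show thesis
    using that by blast
qed

section \<open>Two or three eigenvalues\<close>

text \<open>
  Each coefficient of the polynomial on the right dominates the one on the left.  For three
  numbers the second elementary symmetric function is the product times the sum of the inverses.
\<close>

lemma prod_shift_mono_card_2_3:
  fixes x y :: "'i \<Rightarrow> real"
  assumes card: "card I = 2 \<or> card I = 3"
    and pos: "\<And>i. i \<in> I \<Longrightarrow> 0 < x i" "\<And>i. i \<in> I \<Longrightarrow> 0 < y i"
    and prod_eq: "(\<Prod>i\<in>I. x i) = (\<Prod>i\<in>I. y i)"
    and sum_le: "(\<Sum>i\<in>I. y i) \<le> (\<Sum>i\<in>I. x i)"
    and inv_le: "(\<Sum>i\<in>I. inverse (y i)) \<le> (\<Sum>i\<in>I. inverse (x i))"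
    and t: "0 < t"
  shows "(\<Prod>i\<in>I. t + y i) \<le> (\<Prod>i\<in>I. t + x i)"
  using card
proof
  assume "card I = 2"
  then obtain a b where I: "I = {a, b}" "a \<noteq> b"
    by (auto simp: card_2_iff)
  have "t * (y a + y b) \<le> t * (x a + x b)"
    using sum_le t I by simp
  then show ?thesis
    using prod_eq I by (simp add: algebra_simps)
next
  assume "card I = 3"
  then obtain a b c where I: "I = {a, b, c}" "a \<noteq> b" "a \<noteq> c" "b \<noteq> c"
    by (auto simp: card_3_iff)
  define p where "p = x a * x b * x c"
  have p: "p = y a * y b * y c"
    using prod_eq I by (simp add: p_def mult.assoc)
  have nz: "x a \<noteq> 0" "x b \<noteq> 0" "x c \<noteq> 0" "y a \<noteq> 0" "y b \<noteq> 0" "y c \<noteq> 0"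
    using pos I by (metis insertCI less_irrefl)+
  have "0 < p"
    using pos I by (simp add: p_def)
  then have "p * (inverse (y a) + inverse (y b) + inverse (y c)) \<le>
      p * (inverse (x a) + inverse (x b) + inverse (x c))"
    using inv_le I by (simp add: add.assoc)
  moreover have "p * (inverse (x a) + inverse (x b) + inverse (x c)) =
      x b * x c + x a * x c + x a * x b"
    unfolding p_def using nz by (simp add: field_simps)
  moreover have "p * (inverse (y a) + inverse (y b) + inverse (y c)) =
      y b * y c + y a * y c + y a * y b"
    unfolding p using nz by (simp add: field_simps)
  ultimately have "t * (y b * y c + y a * y c + y a * y b) \<le> t * (x b * x c + x a * x c + x a * x b)"
    using t by simp
  moreover have "t\<^sup>2 * (y a + y b + y c) \<le> t\<^sup>2 * (x a + x b + x c)"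
    using sum_le t I by (simp add: add.assoc)
  moreover have "(\<Prod>i\<in>I. t + z i) = t ^ 3 + t\<^sup>2 * (z a + z b + z c) +
      t * (z b * z c + z a * z c + z a * z b) + z a * z b * z c" for z :: "'i \<Rightarrow> real"
    using I by (simp add: power2_eq_square power3_eq_cube algebra_simps)
  ultimately show ?thesis
    using p by (simp add: p_def)
qed

theorem theorem7:
  fixes P1 P2 :: "real^'n^'n"
  assumes "CARD('n) = 2 \<or> CARD('n) = 3"
    and "sym_pos_def P1" and "sym_pos_def P2"
    and "frobenius_sq P1 \<ge> frobenius_sq P2"
    and "frobenius_sq (matrix_inv P1) \<ge> frobenius_sq (matrix_inv P2)"
    and "det P1 = det P2"
  shows "frobenius_sq (mat_log P1) \<ge> frobenius_sq (mat_log P2)"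
proof -
  obtain Q1 d1 where Q1: "orthogonal_matrix Q1" and d1: "\<And>i. 0 < d1 i"
    and P1: "P1 = conj_diag Q1 d1"
    using sym_pos_def_diagonalization[OF assms(2)] by blast
  obtain Q2 d2 where Q2: "orthogonal_matrix Q2" and d2: "\<And>i. 0 < d2 i"
    and P2: "P2 = conj_diag Q2 d2"
    using sym_pos_def_diagonalization[OF assms(3)] by blast
  have nz: "d1 i \<noteq> 0" "d2 i \<noteq> 0" for i
    using d1[of i] d2[of i] by auto
  have "(\<Sum>i\<in>UNIV. (ln ((d2 i)\<^sup>2))\<^sup>2) \<le> (\<Sum>i\<in>UNIV. (ln ((d1 i)\<^sup>2))\<^sup>2)"
  proof (rule sum_squared_ln_mono_of_prod_shift)
    show prod_eq: "(\<Prod>i\<in>UNIV. (d1 i)\<^sup>2) = (\<Prod>i\<in>UNIV. (d2 i)\<^sup>2)"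
      using assms(6) by (simp add: P1 P2 det_conj_diag Q1 Q2 flip: prod_power_distrib)
    show "(\<Prod>i\<in>UNIV. t + (d2 i)\<^sup>2) \<le> (\<Prod>i\<in>UNIV. t + (d1 i)\<^sup>2)" if "0 < t" for t
    proof (rule prod_shift_mono_card_2_3[OF assms(1) _ _ prod_eq _ _ that])
      show "(\<Sum>i\<in>UNIV. (d2 i)\<^sup>2) \<le> (\<Sum>i\<in>UNIV. (d1 i)\<^sup>2)"
        using assms(4) by (simp add: P1 P2 frobenius_sq_conj_diag Q1 Q2)
      show "(\<Sum>i\<in>UNIV. inverse ((d2 i)\<^sup>2)) \<le> (\<Sum>i\<in>UNIV. inverse ((d1 i)\<^sup>2))"
        using assms(5)
        by (simp add: P1 P2 matrix_inv_conj_diag frobenius_sq_conj_diag Q1 Q2 nz power_inverse)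
    qed (simp_all add: nz)
  qed (simp_all add: nz)
  then have "(\<Sum>i\<in>UNIV. (2 * ln (d2 i))\<^sup>2) \<le> (\<Sum>i\<in>UNIV. (2 * ln (d1 i))\<^sup>2)"
    using d1 d2 by (simp add: ln_realpow)
  then have "(\<Sum>i\<in>UNIV. (ln (d2 i))\<^sup>2) \<le> (\<Sum>i\<in>UNIV. (ln (d1 i))\<^sup>2)"
    by (simp add: power_mult_distrib flip: sum_distrib_left)
  then show ?thesis
    using d1 d2 by (simp add: P1 P2 mat_log_conj_diag frobenius_sq_conj_diag Q1 Q2)
qed

end
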